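(* Let $\Phi$ be a set with a semiflow $\varrho^{(t)}:\Phi\to\Phi$, $t\in\mathbb Z^+$, and let $L_t:\Phi\to\mathbb R^{m\times m}$, $t\in\mathbb Z^+$, be matrix-valued maps defining the generalized matrix sequence map $\mathcal L(t_0,\phi)=\{L_{t+t_0}(\varrho^{(t)}\phi)\}_{t\in\mathbb Z^+}$. Suppose $\mathcal L(t_0,\phi)\subset\mathcal H$ for all $\phi\in\Phi$ and $t_0\ge0$, where $\mathcal H\subset\mathbb R^{m\times m}$ is the class of matrices all of whose row sums are equal to each other. Then $$\sup_{v\in\mathbb R^{m-1},\,v\neq0}\hat\lambda(\mathcal L,\phi,v)=\log\hat\rho(\mathcal L,\phi)=\log\operatorname{diam}(\mathcal L,\phi).$$
   Context: $\mathbb Z^+=\{0,1,2,\dots\}$. In the paper $\{\Phi,\mathcal B,P,\varrho^{(t)}\}$ is a random dynamical system ($\mathcal B$ a $\sigma$-algebra, $P$ a probability measure on $\Phi$, $\varrho^{(t)}$ a semiflow, i.e. $\varrho^{(t+s)}=\varrho^{(t)}\circ\varrho^{(s)}$, $\varrho^{(0)}=\mathrm{id}$). $\prod$ is the left matrix product $\prod_{k=a}^bA_k=A_b\cdots A_a$; $\log 0=-\infty$. Hajnal diameter: for a matrix $L$ with rows $g_1,\dots,g_m$ and a vector norm, $\operatorname{diam}(L)=\max_{i,j}\|g_i-g_j\|$, and $$\operatorname{diam}(\mathcal L,\phi)=\limsup_{t\to\infty}\sup_{t_0\ge0}\Big\{\operatorname{diam}\Big(\prod_{k=t_0}^{t_0+t-1}L_k(\varrho^{(k-t_0)}\phi)\Big)\Big\}^{1/t}.$$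 Projection: let $\mathcal E_0$ be the span of $e_0=[1,\dots,1]^\top$ and $P$ any $(m-1)\times m$ matrix with kernel exactly $\mathcal E_0$. For $L\in\mathcal H$, $\hat L\in\mathbb R^{(m-1)\times(m-1)}$ is the unique solution of $PL=\hat LP$. The projection joint spectral radius and the projection Lyapunov exponent in direction $v\in\mathbb R^{m-1}$ are $$\hat\rho(\mathcal L,\phi)=\limsup_{t\to\infty}\sup_{t_0\ge0}\Big\|\prod_{k=t_0}^{t_0+t-1}\hat L_k(\varrho^{(k-t_0)}\phi)\Big\|^{1/t},$$ $$\hat\lambda(\mathcal L,\phi,v)=\limsup_{t\to\infty}\frac1t\sup_{t_0\ge0}\log\Big\|\prod_{k=t_0}^{t_0+t-1}\hat L_k(\varrho^{(k-t_0)}\phi)v\Big\|,$$ where $\|\cdot\|$ is a vector norm and its induced matrix norm. *)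

theory Defs
  imports
    "HOL-Library.Extended_Real"
    "Jordan_Normal_Form.Matrix_Kernel"
begin

text \<open>
  The dimensions \<open>m\<close> and \<open>m - 1\<close> occur side by side, so vectors and matrices are those of
  the theory \<open>Jordan_Normal_Form.Matrix\<close>, with explicit carriers; \<open>m = 1\<close> is allowed.
  Growth rates live in the extended reals: none of the quantities below is assumed bounded.
\<close>

definition ln_ereal :: "ereal \<Rightarrow> ereal" where
  "ln_ereal x = (if x \<le> 0 then -\<infinity> else if x = \<infinity> then \<infinity> else ereal (ln (real_of_ereal x)))"

definition vec_norm_on :: "nat \<Rightarrow> (real vec \<Rightarrow> real) \<Rightarrow> bool" where
  "vec_norm_on n N \<longleftrightarrow>
    (\<forall>v \<in> carrier_vec n. 0 \<le> N v) \<and>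
    (\<forall>v \<in> carrier_vec n. N v = 0 \<longleftrightarrow> v = 0\<^sub>v n) \<and>
    (\<forall>c. \<forall>v \<in> carrier_vec n. N (c \<cdot>\<^sub>v v) = \<bar>c\<bar> * N v) \<and>
    (\<forall>v \<in> carrier_vec n. \<forall>w \<in> carrier_vec n. N (v + w) \<le> N v + N w)"

text \<open>
  The matrix norm induced by \<open>N\<close>. The closed unit ball is used instead of the unit sphere
  so that the set is nonempty also in dimension \<open>0\<close>.
\<close>
definition induced_norm :: "(real vec \<Rightarrow> real) \<Rightarrow> real mat \<Rightarrow> real" where
  "induced_norm N A = (SUP v \<in> {v \<in> carrier_vec (dim_col A). N v \<le> 1}. N (A *\<^sub>v v))"

definition semiflow :: "'a set \<Rightarrow> (nat \<Rightarrow> 'a \<Rightarrow> 'a) \<Rightarrow> bool" where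
  "semiflow \<Phi> \<rho> \<longleftrightarrow>
    (\<forall>t. \<forall>\<phi> \<in> \<Phi>. \<rho> t \<phi> \<in> \<Phi>) \<and>
    (\<forall>\<phi> \<in> \<Phi>. \<rho> 0 \<phi> = \<phi>) \<and>
    (\<forall>t s. \<forall>\<phi> \<in> \<Phi>. \<rho> (t + s) \<phi> = \<rho> t (\<rho> s \<phi>))"

definition gen_seq_map ::
  "(nat \<Rightarrow> 'a \<Rightarrow> 'a) \<Rightarrow> (nat \<Rightarrow> 'a \<Rightarrow> real mat) \<Rightarrow> nat \<Rightarrow> 'a \<Rightarrow> nat \<Rightarrow> real mat" where
  "gen_seq_map \<rho> L t0 \<phi> = (\<lambda>t. L (t + t0) (\<rho> t \<phi>))"

definition equal_row_sums :: "nat \<Rightarrow> real mat set" where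
  "equal_row_sums m = {A \<in> carrier_mat m m.
    \<forall>i < m. \<forall>j < m. (\<Sum>k < m. A $$ (i, k)) = (\<Sum>k < m. A $$ (j, k))}"

text \<open>\<open>left_prod n A a t\<close> is the product \<open>A (a + t - 1) * \<dots> * A a\<close> of \<open>t\<close> factors.\<close>
primrec left_prod :: "nat \<Rightarrow> (nat \<Rightarrow> real mat) \<Rightarrow> nat \<Rightarrow> nat \<Rightarrow> real mat" where
  "left_prod n A a 0 = 1\<^sub>m n"
| "left_prod n A a (Suc t) = A (a + t) * left_prod n A a t"

definition diam :: "(real vec \<Rightarrow> real) \<Rightarrow> real mat \<Rightarrow> real" where
  "diam N A = Max {N (row A i - row A j) | i j. i < dim_row A \<and> j < dim_row A}"

text \<open>
  In the upper limits below the term at \<open>t = 0\<close>, where \<open>1 / real 0 = 0\<close>, is irrelevant.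
\<close>
definition hajnal_diameter ::
  "nat \<Rightarrow> (real vec \<Rightarrow> real) \<Rightarrow> (nat \<Rightarrow> 'a \<Rightarrow> 'a) \<Rightarrow> (nat \<Rightarrow> 'a \<Rightarrow> real mat) \<Rightarrow> 'a \<Rightarrow> ereal" where
  "hajnal_diameter m N \<rho> L \<phi> =
    limsup (\<lambda>t. SUP t0.
      ereal (diam N (left_prod m (\<lambda>k. L k (\<rho> (k - t0) \<phi>)) t0 t) powr (1 / real t)))"

definition projection_matrix :: "nat \<Rightarrow> real mat \<Rightarrow> bool" where
  "projection_matrix m P \<longleftrightarrow>
    P \<in> carrier_mat (m - 1) m \<and> mat_kernel P = {c \<cdot>\<^sub>v vec m (\<lambda>_. 1) | c. True}"

text \<open>
  For a projection matrix \<open>P\<close> and \<open>A \<in> equal_row_sums m\<close> exactly one such matrix exists: \<open>P\<close> is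
  onto, and \<open>P * A\<close> vanishes on the kernel of \<open>P\<close>.
\<close>
definition proj :: "real mat \<Rightarrow> real mat \<Rightarrow> real mat" where
  "proj P A = (THE B. B \<in> carrier_mat (dim_row P) (dim_row P) \<and> P * A = B * P)"

definition proj_prod ::
  "real mat \<Rightarrow> (nat \<Rightarrow> 'a \<Rightarrow> 'a) \<Rightarrow> (nat \<Rightarrow> 'a \<Rightarrow> real mat) \<Rightarrow> 'a \<Rightarrow> nat \<Rightarrow> nat \<Rightarrow> real mat" where
  "proj_prod P \<rho> L \<phi> t0 t =
    left_prod (dim_row P) (\<lambda>k. proj P (L k (\<rho> (k - t0) \<phi>))) t0 t"

definition proj_joint_spectral_radius ::
  "real mat \<Rightarrow> (real vec \<Rightarrow> real) \<Rightarrow> (nat \<Rightarrow> 'a \<Rightarrow> 'a) \<Rightarrow> (nat \<Rightarrow> 'a \<Rightarrow> real mat) \<Rightarrow> 'a \<Rightarrow> ereal" where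
  "proj_joint_spectral_radius P N \<rho> L \<phi> =
    limsup (\<lambda>t. SUP t0. ereal (induced_norm N (proj_prod P \<rho> L \<phi> t0 t) powr (1 / real t)))"

definition proj_lyapunov_exponent ::
  "real mat \<Rightarrow> (real vec \<Rightarrow> real) \<Rightarrow> (nat \<Rightarrow> 'a \<Rightarrow> 'a) \<Rightarrow> (nat \<Rightarrow> 'a \<Rightarrow> real mat) \<Rightarrow> 'a \<Rightarrow> real vec \<Rightarrow> ereal"
  where
  "proj_lyapunov_exponent P N \<rho> L \<phi> v =
    limsup (\<lambda>t. ereal (1 / real t) *
      (SUP t0. ln_ereal (ereal (N (proj_prod P \<rho> L \<phi> t0 t *\<^sub>v v)))))"

end

theory Submission
  imports Defs "HOL-Analysis.Elementary_Metric_Spaces"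
begin

text \<open>
  Let \<open>C\<close> be a product of the matrices in \<open>equal_row_sums m\<close> and \<open>B\<close> the product of their
  projections, so that \<open>P * C = B * P\<close>. Since \<open>P\<close> annihilates exactly the matrices with equal rows
  and has a right inverse \<open>Q\<close>, the row differences of \<open>C\<close> are those of \<open>Q * B * P\<close>, and
  \<open>B = P * D * Q\<close> where \<open>D\<close> collects the differences between the rows of \<open>C\<close> and its first row.
  By the equivalence of norms, the diameter of \<open>C\<close>, the induced norm of \<open>B\<close>, and the sum of the
  norms of the columns of \<open>B\<close> therefore agree up to constants, independently of \<open>t0\<close> and \<open>t\<close>.
  Constant factors do not affect exponential growth rates, and the growth rate of a finite sum
  is the largest growth rate of its terms.
\<close>

section \<open>Exponential growth rates\<close>


text \<open>An upper limit bounded by \<open>y\<close> gives eventual bounds only above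
  \<open>y\<close>, hence the slack \<open>z > y\<close>; conversely the reals above
  \<open>y\<close> are dense enough to squeeze the limsup down to \<open>y\<close>.\<close>

lemma limsup_le_ereal_iff:
  fixes X :: "nat \<Rightarrow> ereal"
  shows "limsup X \<le> ereal y \<longleftrightarrow> (\<forall>z>y. eventually (\<lambda>t. X t \<le> ereal z) sequentially)"
proof
  assume *: "limsup X \<le> ereal y"
  show "\<forall>z>y. eventually (\<lambda>t. X t \<le> ereal z) sequentially"
  proof (intro allI impI)
    fix z assume "y < z"
    then have "limsup X < ereal z" using * by (metis ereal_less_eq(3) not_le order.trans)
    then show "eventually (\<lambda>t. X t \<le> ereal z) sequentially"
      by (auto dest!: Limsup_lessD elim: eventually_mono)
  qed
next
  assume *: "\<forall>z>y. eventually (\<lambda>t. X t \<le> ereal z) sequentially"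
  have "limsup X \<le> ereal z" if "y < z" for z
    by (rule Limsup_bounded) (use * that in auto)
  then show "limsup X \<le> ereal y"
    by (metis ereal_dense2 ereal_less_eq(3) less_ereal.simps(1) not_le order.trans)
qed

text \<open>The adjunction between logarithm and exponential lets \<open>ln_ereal\<close> pass
  through suprema and upper limits without any continuity argument.\<close>

lemma ln_ereal_le_iff: "ln_ereal x \<le> ereal y \<longleftrightarrow> x \<le> ereal (exp y)"
proof (cases x)
  case (real r)
  then show ?thesis
    using exp_gt_zero[of y] ln_le_cancel_iff[of r "exp y"]
    by (cases "r \<le> 0") (auto simp: ln_ereal_def intro: order_trans[of _ 0])
qed (auto simp: ln_ereal_def)

text \<open>Real upper bounds determine an extended real: \<infinity> has none and -\<infinity> has
  all of them. Equalities of growth rates are proved this way.\<close>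

lemma ereal_eqI_le_real:
  fixes a b :: ereal
  assumes "\<And>y. a \<le> ereal y \<longleftrightarrow> b \<le> ereal y"
  shows "a = b"
proof (rule antisym)
  show "a \<le> b" by (rule ereal_le_real) (simp add: assms)
  show "b \<le> a" by (rule ereal_le_real) (simp flip: assms)
qed

text \<open>The exponential growth rate in \<open>t\<close>, uniform in the starting time
  \<open>t0\<close>. It has the shape of the Lyapunov exponent, and the logarithms of the other two
  quantities are brought to this form as well.\<close>

definition growth :: "(nat \<Rightarrow> nat \<Rightarrow> real) \<Rightarrow> ereal" where
  "growth f = limsup (\<lambda>t. ereal (1 / real t) * (SUP t0. ln_ereal (ereal (f t0 t))))"

text \<open>For \<open>t > 0\<close> the factor \<open>1 / real t\<close> moves to the other side,
  even when the supremum is infinite; the term at \<open>t = 0\<close> is lost in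
  \<open>eventually\<close>. What remains is a plain inequality between reals, uniform in
  \<open>t0\<close>.\<close>

lemma growth_le_iff:
  "growth f \<le> ereal y \<longleftrightarrow>
    (\<forall>z>y. eventually (\<lambda>t. \<forall>t0. f t0 t \<le> exp (real t * z)) sequentially)"
proof -
  have "ereal (1 / real t) * (SUP t0. ln_ereal (ereal (f t0 t))) \<le> ereal z \<longleftrightarrow>
      (\<forall>t0. f t0 t \<le> exp (real t * z))" if "t > 0" for t z
  proof -
    have "ereal (1 / real t) * S \<le> ereal z \<longleftrightarrow> S \<le> ereal (real t * z)" for S
      using that by (cases S) (auto simp: field_simps)
    then show ?thesis by (simp add: SUP_le_iff ln_ereal_le_iff)
  qed
  then have "eventually (\<lambda>t. ereal (1 / real t) * (SUP t0. ln_ereal (ereal (f t0 t))) \<le> ereal z) sequentially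
      \<longleftrightarrow> eventually (\<lambda>t. \<forall>t0. f t0 t \<le> exp (real t * z)) sequentially" for z
    by (intro eventually_cong eventually_mono[OF eventually_gt_at_top[of 0]]) auto
  then show ?thesis
    by (simp add: growth_def limsup_le_ereal_iff)
qed

text \<open>Both sides have the same real upper bounds: the \<open>t\<close>-th root is below
  \<open>exp z\<close> exactly when \<open>f t0 t\<close> is below
  \<open>exp (real t * z)\<close>.\<close>

lemma ln_limsup_powr_eq_growth:
  assumes "\<And>t0 t. 0 \<le> f t0 t"
  shows "ln_ereal (limsup (\<lambda>t. SUP t0. ereal (f t0 t powr (1 / real t)))) = growth f"
proof (rule ereal_eqI_le_real)
  fix y
  have "x powr (1 / real t) \<le> exp z \<longleftrightarrow> x \<le> exp (real t * z)" if "t > 0" "0 \<le> x" for t x z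
  \<comment> \<open>A power of 0 is 0, so both inequalities hold for \<open>x = 0\<close>; the
    computation with \<open>ln\<close> requires \<open>x > 0\<close>.\<close>
  proof (cases "x = 0")
    case False
    then have "x > 0" using that by simp
    have "x powr (1 / real t) \<le> exp z \<longleftrightarrow> ln x / real t \<le> z"
      using \<open>x > 0\<close> by (simp add: powr_def)
    also have "\<dots> \<longleftrightarrow> ln x \<le> real t * z" using that by (simp add: field_simps)
    also have "\<dots> \<longleftrightarrow> x \<le> exp (real t * z)"
      using \<open>x > 0\<close> ln_le_cancel_iff[of x "exp (real t * z)"] by simp
    finally show ?thesis .
  qed simp
  then have ev: "eventually (\<lambda>t. (SUP t0. ereal (f t0 t powr (1 / real t))) \<le> ereal (exp z)) sequentially
      \<longleftrightarrow> eventually (\<lambda>t. \<forall>t0. f t0 t \<le> exp (real t * z)) sequentially" for z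
    by (intro eventually_cong eventually_mono[OF eventually_gt_at_top[of 0]])
      (auto simp: SUP_le_iff assms)
  \<comment> \<open>Every \<open>w > exp y\<close> is positive, hence of the form
    \<open>exp z\<close> with \<open>z = ln w > y\<close>.\<close>
  have "(\<forall>w>exp y. Q w) \<longleftrightarrow> (\<forall>z>y. Q (exp z))" for Q :: "real \<Rightarrow> bool"
    by (metis exp_gt_zero exp_less_cancel_iff exp_ln less_trans)
  then show "ln_ereal (limsup (\<lambda>t. SUP t0. ereal (f t0 t powr (1 / real t)))) \<le> ereal y
      \<longleftrightarrow> growth f \<le> ereal y"
    by (simp add: ln_ereal_le_iff limsup_le_ereal_iff growth_le_iff ev)
qed

text \<open>Finitely many eventual bounds hold simultaneously, so the sum is at most
  \<open>card I * exp (real t * w)\<close>, and a slightly larger exponent absorbs the constant. For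
  empty \<open>I\<close> both sides are -\<infinity>.\<close>

lemma growth_le_SUP:
  assumes "finite I" and "0 < K"
    and le: "\<And>t0 t. f t0 t \<le> K * (\<Sum>i\<in>I. g i t0 t)"
  shows "growth f \<le> (SUP i\<in>I. growth (g i))"
proof (rule ereal_le_real)
  show "growth f \<le> ereal y" if "(SUP i\<in>I. growth (g i)) \<le> ereal y" for y
    unfolding growth_le_iff
  proof (intro allI impI)
    fix z assume "y < z"
    \<comment> \<open>The terms are bounded with rate \<open>w\<close>; the gap
      \<open>z - w > 0\<close> is reserved for the constant factor.\<close>
    define w where "w = (y + z) / 2"
    have w: "y < w" "w < z" using \<open>y < z\<close> by (auto simp: w_def)
    have "growth (g i) \<le> ereal y" if "i \<in> I" for i
      using \<open>(SUP i\<in>I. growth (g i)) \<le> ereal y\<close> that by (simp add: SUP_le_iff)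
    then have "eventually (\<lambda>t. \<forall>i\<in>I. \<forall>t0. g i t0 t \<le> exp (real t * w)) sequentially"
      using w \<open>finite I\<close> by (intro eventually_ball_finite) (auto simp: growth_le_iff)
    moreover have "filterlim (\<lambda>t. (z - w) * real t) at_top sequentially"
      using w by (intro filterlim_tendsto_pos_mult_at_top[OF tendsto_const] filterlim_real_sequentially) auto
    \<comment> \<open>The summand 1 keeps the argument of \<open>ln\<close> positive when
      \<open>I\<close> is empty.\<close>
    then have "eventually (\<lambda>t. ln (K * (card I + 1)) \<le> (z - w) * real t) sequentially"
      by (auto simp: filterlim_at_top)
    ultimately show "eventually (\<lambda>t. \<forall>t0. f t0 t \<le> exp (real t * z)) sequentially"
    proof eventually_elim
      case (elim t)
      show ?case
      proof
        fix t0
        have K: "K * (card I + 1) \<le> exp (real t * (z - w))"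
          using elim(2) \<open>0 < K\<close> ln_le_cancel_iff[of "K * (card I + 1)" "exp (real t * (z - w))"]
          by (simp add: mult.commute add_nonneg_pos)
        have "f t0 t \<le> K * (\<Sum>i\<in>I. g i t0 t)" by (rule le)
        also have "\<dots> \<le> K * (card I * exp (real t * w))"
          using elim(1) \<open>0 < K\<close> by (intro mult_left_mono sum_bounded_above) auto
        also have "\<dots> \<le> (K * (card I + 1)) * exp (real t * w)"
          using \<open>0 < K\<close> by (simp add: algebra_simps)
        also have "\<dots> \<le> exp (real t * (z - w)) * exp (real t * w)"
          by (intro mult_right_mono K) auto
        also have "\<dots> = exp (real t * z)"
          by (simp add: algebra_simps flip: exp_add)
        finally show "f t0 t \<le> exp (real t * z)" .
      qed
    qed
  qed
qed

text \<open>The case of a single summand. Used in both directions, it shows that quantities equal up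
  to constant factors have equal growth.\<close>

lemma growth_mono:
  assumes "0 < K" and "\<And>t0 t. f t0 t \<le> K * g t0 t"
  shows "growth f \<le> growth g"
  using growth_le_SUP[of "{()}" K f "\<lambda>_. g"] assms by simp

section \<open>Norms of vectors and matrices\<close>

lemma vec_norm_on_nonneg: "vec_norm_on n N \<Longrightarrow> v \<in> carrier_vec n \<Longrightarrow> 0 \<le> N v"
  by (simp add: vec_norm_on_def)

lemma vec_norm_on_smult: "vec_norm_on n N \<Longrightarrow> v \<in> carrier_vec n \<Longrightarrow> N (c \<cdot>\<^sub>v v) = \<bar>c\<bar> * N v"
  by (simp add: vec_norm_on_def)

lemma vec_norm_on_pos: "vec_norm_on n N \<Longrightarrow> v \<in> carrier_vec n \<Longrightarrow> v \<noteq> 0\<^sub>v n \<Longrightarrow> 0 < N v"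
  by (simp add: vec_norm_on_def less_le)

lemma vec_norm_on_zero: "vec_norm_on n N \<Longrightarrow> N (0\<^sub>v n) = 0"
  unfolding vec_norm_on_def using zero_carrier_vec[of n, where ?'a = real] by blast

lemma vec_norm_on_le_sum:
  assumes N: "vec_norm_on n N" and v: "v \<in> carrier_vec n"
  shows "N v \<le> (\<Sum>i<n. \<bar>v $ i\<bar> * N (unit_vec n i))"
proof -
  \<comment> \<open>Induction on the number \<open>k\<close> of coordinates kept; each step adds one
    multiple of a unit vector by the triangle inequality.\<close>
  have "N (vec n (\<lambda>i. if i < k then v $ i else 0)) \<le> (\<Sum>i<k. \<bar>v $ i\<bar> * N (unit_vec n i))"
    if "k \<le> n" for k using that
  proof (induction k)
    case 0
    have "vec n (\<lambda>i. if i < 0 then v $ i else 0) = 0\<^sub>v n" by auto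
    then show ?case using vec_norm_on_zero[OF N] by simp
  next
    case (Suc k)
    have "vec n (\<lambda>i. if i < Suc k then v $ i else 0) =
        vec n (\<lambda>i. if i < k then v $ i else 0) + v $ k \<cdot>\<^sub>v unit_vec n k"
      using Suc.prems by (intro eq_vecI) (auto simp: less_Suc_eq)
    moreover have "N (v $ k \<cdot>\<^sub>v unit_vec n k) = \<bar>v $ k\<bar> * N (unit_vec n k)"
      using N by (simp add: vec_norm_on_def)
    moreover have "N (x + y) \<le> N x + N y" if "x \<in> carrier_vec n" "y \<in> carrier_vec n" for x y
      using N that by (simp add: vec_norm_on_def)
    ultimately have "N (vec n (\<lambda>i. if i < Suc k then v $ i else 0)) \<le>
        N (vec n (\<lambda>i. if i < k then v $ i else 0)) + \<bar>v $ k\<bar> * N (unit_vec n k)"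
      by (metis smult_carrier_vec unit_vec_carrier vec_carrier)
    then show ?case using Suc by simp
  qed
  from this[of n] have "N (vec n (\<lambda>i. if i < n then v $ i else 0)) \<le> (\<Sum>i<n. \<bar>v $ i\<bar> * N (unit_vec n i))"
    by simp
  moreover have "vec n (\<lambda>i. if i < n then v $ i else 0) = v" using v by auto
  ultimately show ?thesis by simp
qed

lemma vec_norm_on_upper:
  assumes N: "vec_norm_on n N"
  obtains K where "0 < K" "\<And>v :: real vec. v \<in> carrier_vec n \<Longrightarrow> N v \<le> K * (\<Sum>i<n. \<bar>v $ i\<bar>)"
proof
  have N0: "0 \<le> N (unit_vec n i)" for i using N by (simp add: vec_norm_on_def)
  \<comment> \<open>The summand 1 makes the constant positive also for \<open>n = 0\<close>.\<close>
  let ?K = "1 + (\<Sum>i<n. N (unit_vec n i))"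
  show "0 < ?K" using N0 by (simp add: add_pos_nonneg sum_nonneg)
  fix v :: "real vec" assume v: "v \<in> carrier_vec n"
  have "N v \<le> (\<Sum>i<n. \<bar>v $ i\<bar> * N (unit_vec n i))" by (rule vec_norm_on_le_sum[OF N v])
  also have "\<dots> \<le> (\<Sum>i<n. \<bar>v $ i\<bar> * ?K)"
  proof (intro sum_mono mult_left_mono)
    fix i assume "i \<in> {..<n}"
    then have "N (unit_vec n i) \<le> (\<Sum>i<n. N (unit_vec n i))" by (intro member_le_sum N0) auto
    then show "N (unit_vec n i) \<le> ?K" by simp
  qed auto
  finally show "N v \<le> ?K * (\<Sum>i<n. \<bar>v $ i\<bar>)" by (simp add: sum_distrib_right mult.commute)
qed

text \<open>By compactness: without such a constant there are vectors of l1-norm 1 whose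
  \<open>N\<close>-norms tend to 0. A coordinatewise limit of a subsequence has l1-norm 1 but
  \<open>N\<close>-norm 0, a contradiction.\<close>

lemma vec_norm_on_lower:
  assumes N: "vec_norm_on n N"
  obtains K where "0 < K" "\<And>v :: real vec. v \<in> carrier_vec n \<Longrightarrow> (\<Sum>i<n. \<bar>v $ i\<bar>) \<le> K * N v"
proof (rule ccontr)
  assume "\<not> thesis"
  then have "\<exists>v \<in> carrier_vec n. real (Suc k) * N v < (\<Sum>i<n. \<bar>v $ i\<bar>)" for k
    using that[of "real (Suc k)"] by force
  then obtain u where u: "\<And>k. u k \<in> carrier_vec n"
    and less: "\<And>k. real (Suc k) * N (u k) < (\<Sum>i<n. \<bar>u k $ i\<bar>)" by metis
  have N0: "0 \<le> N v" if "v \<in> carrier_vec n" for v using N that by (simp add: vec_norm_on_def)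
  define s where "s k = (\<Sum>i<n. \<bar>u k $ i\<bar>)" for k
  have s: "0 < s k" for k
    using le_less_trans[OF _ less[of k], of 0] N0[OF u[of k]] by (simp add: s_def)
  define w where "w k = (1 / s k) \<cdot>\<^sub>v u k" for k
  have w: "w k \<in> carrier_vec n" for k using u by (simp add: w_def)
  have w1: "(\<Sum>i<n. \<bar>w k $ i\<bar>) = 1" for k
  proof -
    have "(\<Sum>i<n. \<bar>w k $ i\<bar>) = (\<Sum>i<n. \<bar>u k $ i\<bar> / s k)"
      using u s[of k] by (intro sum.cong) (auto simp: w_def abs_mult carrier_vecD[OF u])
    also have "\<dots> = 1" using s[of k] by (simp add: s_def flip: sum_divide_distrib)
    finally show ?thesis .
  qed
  have Nw: "N (w k) \<le> 1 / real (Suc k)" for k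
  proof -
    have "N (w k) = N (u k) / s k"
      using N u[of k] s[of k] by (simp add: w_def vec_norm_on_def)
    also have "\<dots> \<le> 1 / real (Suc k)"
      using less[of k] s[of k] unfolding s_def by (simp add: field_simps)
    finally show ?thesis .
  qed
  have "\<bar>w k $ i\<bar> \<le> 1" if "i < n" for k i
    using member_le_sum[of i "{..<n}" "\<lambda>i. \<bar>w k $ i\<bar>"] that w1[of k] by simp
  then have "bounded ((\<lambda>f. f i) ` range (\<lambda>k i. w k $ i))" if "i \<in> {..<n}" for i
    using that by (auto simp: bounded_iff intro!: exI[of _ 1])
  \<comment> \<open>Bolzano-Weierstrass for finitely many bounded coordinates, with vectors read as
    functions of the index: one subsequence \<open>r\<close> serves all of them.\<close>
  from compact_lemma_general[where proj = "\<lambda>f. f" and unproj = "\<lambda>f. f", OF finite_lessThan this]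
  have "\<exists>l r. strict_mono (r :: nat \<Rightarrow> nat) \<and> (\<forall>e>0. eventually
      (\<lambda>k. \<forall>i\<in>{..<n}. dist (w (r k) $ i) (l i) < e) sequentially)"
    by (simp del: lessThan_iff)
  then obtain l r where r: "strict_mono (r :: nat \<Rightarrow> nat)"
    and l: "\<And>e. 0 < e \<Longrightarrow> eventually (\<lambda>k. \<forall>i\<in>{..<n}. dist (w (r k) $ i) (l i) < e) sequentially"
    by blast
  have lim: "(\<lambda>k. w (r k) $ i) \<longlonglongrightarrow> l i" if "i < n" for i
    using that by (intro tendstoI) (auto elim: eventually_mono[OF l])
  define v where "v = vec n l"
  have v: "v \<in> carrier_vec n" by (simp add: v_def)
  obtain K where K: "\<And>v :: real vec. v \<in> carrier_vec n \<Longrightarrow> N v \<le> K * (\<Sum>i<n. \<bar>v $ i\<bar>)"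
    using vec_norm_on_upper[OF N] by metis
  have "(\<lambda>k. \<Sum>i<n. \<bar>w (r k) $ i\<bar>) \<longlonglongrightarrow> (\<Sum>i<n. \<bar>l i\<bar>)"
    by (intro tendsto_sum tendsto_rabs lim) auto
  then have "(\<Sum>i<n. \<bar>l i\<bar>) = 1" by (simp add: w1 LIMSEQ_const_iff)
  \<comment> \<open>Split \<open>v\<close> as \<open>(v - w (r k)) + w (r k)\<close>. The upper
    bound by the l1-norm makes the first part small, and \<open>Nw\<close> the second.\<close>
  have "N v \<le> 0"
  proof (rule LIMSEQ_le_const)
    have "(\<lambda>k. K * (\<Sum>i<n. \<bar>l i - w (r k) $ i\<bar>) + 1 / real (Suc (r k)))
        \<longlonglongrightarrow> K * (\<Sum>i<n. \<bar>l i - l i\<bar>) + 0"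
      using LIMSEQ_subseq_LIMSEQ[OF LIMSEQ_Suc[OF lim_1_over_n] r]
      by (intro tendsto_intros lim) (auto simp: o_def)
    then show "(\<lambda>k. K * (\<Sum>i<n. \<bar>l i - w (r k) $ i\<bar>) + 1 / real (Suc (r k))) \<longlonglongrightarrow> 0" by simp
    have "N v \<le> K * (\<Sum>i<n. \<bar>l i - w (r k) $ i\<bar>) + 1 / real (Suc (r k))" for k
    proof -
      have "N ((v - w (r k)) + w (r k)) \<le> N (v - w (r k)) + N (w (r k))"
        using N v w[of "r k"] by (simp add: vec_norm_on_def)
      moreover have "(v - w (r k)) + w (r k) = v"
        using v w[of "r k"] by (intro eq_vecI) auto
      moreover have "N (v - w (r k)) \<le> K * (\<Sum>i<n. \<bar>l i - w (r k) $ i\<bar>)"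
        using K[of "v - w (r k)"] v w[of "r k"] by (simp add: v_def)
      ultimately show ?thesis using Nw[of "r k"] by simp
    qed
    then show "\<exists>k0. \<forall>k\<ge>k0. N v \<le> K * (\<Sum>i<n. \<bar>l i - w (r k) $ i\<bar>) + 1 / real (Suc (r k))" by blast
  qed
  then have "v = 0\<^sub>v n" using N v N0[OF v] by (simp add: vec_norm_on_def)
  then have "l i = 0" if "i < n" for i using that unfolding v_def by (metis index_vec index_zero_vec(1))
  with \<open>(\<Sum>i<n. \<bar>l i\<bar>) = 1\<close> show False by simp
qed

section \<open>The entrywise l1-norm and its comparison with the induced norm\<close>

text \<open>The entrywise l1-norm is the common yardstick for induced norm, columns and diameter. It
  makes sense for every shape, so it also measures the rectangular \<open>P\<close> and its right
  inverse.\<close>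

definition entry_sum :: "real mat \<Rightarrow> real" where
  "entry_sum A = (\<Sum>i<dim_row A. \<Sum>j<dim_col A. \<bar>A $$ (i, j)\<bar>)"

lemma entry_sum_nonneg: "0 \<le> entry_sum A"
  by (simp add: entry_sum_def sum_nonneg)

lemma row_sum_le_entry_sum:
  assumes "i < dim_row A"
  shows "(\<Sum>j<dim_col A. \<bar>A $$ (i, j)\<bar>) \<le> entry_sum A"
  unfolding entry_sum_def
  using member_le_sum[of i "{..<dim_row A}" "\<lambda>i. \<Sum>j<dim_col A. \<bar>A $$ (i, j)\<bar>"] assms
  by (simp add: sum_nonneg)

lemma index_mult_mat_sum:
  assumes "A \<in> carrier_mat n k" "B \<in> carrier_mat k p" "i < n" "j < p"
  shows "(A * B) $$ (i, j) = (\<Sum>l<k. A $$ (i, l) * B $$ (l, j))"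
  using assms by (auto simp: scalar_prod_def lessThan_atLeast0)

lemma index_mult_mat_vec_sum:
  assumes "A \<in> carrier_mat n k" "v \<in> carrier_vec k" "i < n"
  shows "(A *\<^sub>v v) $ i = (\<Sum>l<k. A $$ (i, l) * v $ l)"
  using assms by (auto simp: scalar_prod_def lessThan_atLeast0)

text \<open>After the triangle inequality and an exchange of sums, \<open>A $$ (i, l)\<close>
  multiplies the absolute sum of row \<open>l\<close> of \<open>B\<close>, which is at most
  \<open>entry_sum B\<close>.\<close>

lemma entry_sum_mult:
  assumes A: "A \<in> carrier_mat n k" and B: "B \<in> carrier_mat k p"
  shows "entry_sum (A * B) \<le> entry_sum A * entry_sum B"
proof -
  have "entry_sum (A * B) = (\<Sum>i<n. \<Sum>j<p. \<bar>\<Sum>l<k. A $$ (i, l) * B $$ (l, j)\<bar>)"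
    using A B by (auto simp: entry_sum_def index_mult_mat_sum[OF A B] simp del: index_mult_mat(1) intro!: sum.cong)
  also have "\<dots> \<le> (\<Sum>i<n. \<Sum>j<p. \<Sum>l<k. \<bar>A $$ (i, l)\<bar> * \<bar>B $$ (l, j)\<bar>)"
    by (intro sum_mono order_trans[OF sum_abs]) (simp add: abs_mult)
  also have "\<dots> = (\<Sum>i<n. \<Sum>l<k. \<bar>A $$ (i, l)\<bar> * (\<Sum>j<p. \<bar>B $$ (l, j)\<bar>))"
    by (subst sum.swap) (simp add: sum_distrib_left)
  also have "\<dots> \<le> (\<Sum>i<n. \<Sum>l<k. \<bar>A $$ (i, l)\<bar> * entry_sum B)"
    using B row_sum_le_entry_sum[of _ B] by (intro sum_mono mult_left_mono) auto
  also have "\<dots> = entry_sum A * entry_sum B"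
    using A by (simp add: entry_sum_def sum_distrib_right)
  finally show ?thesis .
qed

lemma entry_sum_mult3:
  assumes A: "A \<in> carrier_mat n k" and B: "B \<in> carrier_mat k p" and C: "C \<in> carrier_mat p q"
  shows "entry_sum (A * B * C) \<le> entry_sum A * entry_sum B * entry_sum C"
  using entry_sum_mult[OF mult_carrier_mat[OF A B] C] entry_sum_mult[OF A B]
  by (meson entry_sum_nonneg mult_right_mono order_trans)

text \<open>Pass from \<open>N\<close> to the l1-norm, estimate there, and return: the constant is
  the product of the two equivalence constants, independent of \<open>B\<close> and
  \<open>v\<close>.\<close>

lemma norm_mult_mat_vec_le:
  assumes N: "vec_norm_on n N"
  obtains K where "0 < K"
    "\<And>(B :: real mat) v. B \<in> carrier_mat n n \<Longrightarrow> v \<in> carrier_vec n \<Longrightarrow> N (B *\<^sub>v v) \<le> K * entry_sum B * N v"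
proof -
  obtain K1 where K1: "0 < K1" "\<And>v :: real vec. v \<in> carrier_vec n \<Longrightarrow> N v \<le> K1 * (\<Sum>i<n. \<bar>v $ i\<bar>)"
    using vec_norm_on_upper[OF N] by metis
  obtain K2 where K2: "0 < K2" "\<And>v :: real vec. v \<in> carrier_vec n \<Longrightarrow> (\<Sum>i<n. \<bar>v $ i\<bar>) \<le> K2 * N v"
    using vec_norm_on_lower[OF N] by metis
  show thesis
  proof
    show "0 < K1 * K2" using K1 K2 by simp
    fix B :: "real mat" and v :: "real vec" assume B: "B \<in> carrier_mat n n" and v: "v \<in> carrier_vec n"
    have "(\<Sum>i<n. \<bar>(B *\<^sub>v v) $ i\<bar>) = (\<Sum>i<n. \<bar>\<Sum>l<n. B $$ (i, l) * v $ l\<bar>)"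
      by (intro sum.cong) (auto simp: index_mult_mat_vec_sum[OF B v] simp del: index_mult_mat_vec)
    also have "\<dots> \<le> (\<Sum>i<n. \<Sum>l<n. \<bar>B $$ (i, l)\<bar> * \<bar>v $ l\<bar>)"
      by (intro sum_mono order_trans[OF sum_abs]) (simp add: abs_mult)
    also have "\<dots> \<le> (\<Sum>i<n. \<Sum>l<n. \<bar>B $$ (i, l)\<bar> * (\<Sum>l<n. \<bar>v $ l\<bar>))"
      by (intro sum_mono mult_left_mono member_le_sum) auto
    also have "\<dots> = entry_sum B * (\<Sum>l<n. \<bar>v $ l\<bar>)"
      using B by (simp add: entry_sum_def sum_distrib_right)
    finally have le: "(\<Sum>i<n. \<bar>(B *\<^sub>v v) $ i\<bar>) \<le> entry_sum B * (\<Sum>l<n. \<bar>v $ l\<bar>)" .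
    have "N (B *\<^sub>v v) \<le> K1 * (\<Sum>i<n. \<bar>(B *\<^sub>v v) $ i\<bar>)"
      using B v by (intro K1) auto
    also have "\<dots> \<le> K1 * (entry_sum B * (K2 * N v))"
      using K1 K2(2)[OF v] by (intro mult_left_mono order_trans[OF le]) (auto simp: entry_sum_nonneg)
    finally show "N (B *\<^sub>v v) \<le> K1 * K2 * entry_sum B * N v" by (simp add: mult_ac)
  qed
qed

text \<open>The columns of \<open>B\<close> are the images of the unit vectors. This bounds a matrix
  norm by finitely many norms of images of fixed vectors, the form in which
  \<open>growth_le_SUP\<close> applies.\<close>

lemma entry_sum_le_columns:
  assumes N: "vec_norm_on n N"
  obtains K where "0 < K"
    "\<And>B. B \<in> carrier_mat n n \<Longrightarrow> entry_sum B \<le> K * (\<Sum>j<n. N (B *\<^sub>v unit_vec n j))"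
proof -
  obtain K where K: "0 < K" "\<And>v :: real vec. v \<in> carrier_vec n \<Longrightarrow> (\<Sum>i<n. \<bar>v $ i\<bar>) \<le> K * N v"
    using vec_norm_on_lower[OF N] by metis
  show thesis
  proof
    show "0 < K" by fact
    fix B :: "real mat" assume B: "B \<in> carrier_mat n n"
    have "entry_sum B = (\<Sum>j<n. \<Sum>i<n. \<bar>B $$ (i, j)\<bar>)"
      using B sum.swap[of "\<lambda>i j. \<bar>B $$ (i, j)\<bar>" "{..<n}" "{..<n}"] by (simp add: entry_sum_def)
    also have "\<dots> = (\<Sum>j<n. \<Sum>i<n. \<bar>(B *\<^sub>v unit_vec n j) $ i\<bar>)"
      using B by (intro sum.cong) auto
    also have "\<dots> \<le> (\<Sum>j<n. K * N (B *\<^sub>v unit_vec n j))"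
      using B by (intro sum_mono K) auto
    finally show "entry_sum B \<le> K * (\<Sum>j<n. N (B *\<^sub>v unit_vec n j))"
      by (simp add: sum_distrib_left)
  qed
qed

text \<open>A supremum of reals is informative only over a nonempty set that is bounded above: the
  zero vector gives the former, \<open>norm_mult_mat_vec_le\<close> the latter.\<close>

lemma induced_norm_bounds:
  assumes N: "vec_norm_on n N"
  obtains K where "0 < K"
    "\<And>B. B \<in> carrier_mat n n \<Longrightarrow> induced_norm N B \<le> K * entry_sum B"
    "\<And>B v. B \<in> carrier_mat n n \<Longrightarrow> v \<in> carrier_vec n \<Longrightarrow> N v \<le> 1 \<Longrightarrow> N (B *\<^sub>v v) \<le> induced_norm N B"
proof -
  obtain K where K: "0 < K" "\<And>B v. B \<in> carrier_mat n n \<Longrightarrow> v \<in> carrier_vec n \<Longrightarrow>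
      N (B *\<^sub>v v) \<le> K * entry_sum B * N v"
    using norm_mult_mat_vec_le[OF N] by metis
  have le: "N (B *\<^sub>v v) \<le> K * entry_sum B"
    if "B \<in> carrier_mat n n" "v \<in> carrier_vec n" "N v \<le> 1" for B v
  proof -
    have "K * entry_sum B * N v \<le> K * entry_sum B * 1"
      using that(3) K(1) by (intro mult_left_mono) (auto simp: entry_sum_nonneg)
    then show ?thesis using K(2)[OF that(1,2)] by simp
  qed
  show thesis
  proof
    fix B :: "real mat" assume B: "B \<in> carrier_mat n n"
    have eq: "induced_norm N B = (SUP v \<in> {v \<in> carrier_vec n. N v \<le> 1}. N (B *\<^sub>v v))"
      using B by (simp add: induced_norm_def)
    have "0\<^sub>v n \<in> {v \<in> carrier_vec n. N v \<le> 1}" using vec_norm_on_zero[OF N] by simp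
    then show "induced_norm N B \<le> K * entry_sum B"
      unfolding eq using le[OF B] by (intro cSUP_least) blast+
    show "N (B *\<^sub>v v) \<le> induced_norm N B" if "v \<in> carrier_vec n" "N v \<le> 1" for v
      unfolding eq using le[OF B] that by (intro cSUP_upper bdd_aboveI2[where M = "K * entry_sum B"]) auto
  qed (rule K(1))
qed

lemma induced_norm_nonneg:
  assumes N: "vec_norm_on n N" and B: "B \<in> carrier_mat n n"
  shows "0 \<le> induced_norm N B"
proof -
  obtain K where "\<And>B v. B \<in> carrier_mat n n \<Longrightarrow> v \<in> carrier_vec n \<Longrightarrow> N v \<le> 1 \<Longrightarrow>
      N (B *\<^sub>v v) \<le> induced_norm N B"
    using induced_norm_bounds[OF N] by metis
  from this[OF B, of "0\<^sub>v n"] have "N (B *\<^sub>v 0\<^sub>v n) \<le> induced_norm N B"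
    using vec_norm_on_zero[OF N] by simp
  moreover have "0 \<le> N (B *\<^sub>v 0\<^sub>v n)" using B by (intro vec_norm_on_nonneg[OF N]) auto
  ultimately show ?thesis by simp
qed

text \<open>Unit vectors need not have \<open>N\<close>-norm 1, so they are rescaled into the unit
  ball and the column bound is multiplied by their norms.\<close>

lemma entry_sum_le_induced_norm:
  assumes N: "vec_norm_on n N"
  obtains K where "0 < K" "\<And>B. B \<in> carrier_mat n n \<Longrightarrow> entry_sum B \<le> K * induced_norm N B"
proof -
  obtain K where K: "0 < K"
    "\<And>B. B \<in> carrier_mat n n \<Longrightarrow> entry_sum B \<le> K * (\<Sum>j<n. N (B *\<^sub>v unit_vec n j))"
    using entry_sum_le_columns[OF N] by metis
  obtain K' where K': "\<And>B v. B \<in> carrier_mat n n \<Longrightarrow> v \<in> carrier_vec n \<Longrightarrow> N v \<le> 1 \<Longrightarrow>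
      N (B *\<^sub>v v) \<le> induced_norm N B"
    using induced_norm_bounds[OF N] by metis
  let ?K = "K * (1 + (\<Sum>j<n. N (unit_vec n j)))"
  show thesis
  proof
    have "0 \<le> (\<Sum>j<n. N (unit_vec n j))" by (intro sum_nonneg vec_norm_on_nonneg[OF N]) auto
    then show "0 < ?K" using K(1) by simp
    fix B :: "real mat" assume B: "B \<in> carrier_mat n n"
    have col: "N (B *\<^sub>v unit_vec n j) \<le> N (unit_vec n j) * induced_norm N B" if j: "j < n" for j
    proof -
      have "unit_vec n j \<noteq> (0\<^sub>v n :: real vec)" using j by (metis index_unit_vec(2) index_zero_vec(1) zero_neq_one)
      then have pos: "0 < N (unit_vec n j)"
        by (intro vec_norm_on_pos[OF N]) auto
      define e where "e = (1 / N (unit_vec n j)) \<cdot>\<^sub>v unit_vec n j"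
      have e: "e \<in> carrier_vec n" by (simp add: e_def)
      have "N e = 1" using pos by (simp add: e_def vec_norm_on_smult[OF N])
      then have "N (B *\<^sub>v e) \<le> induced_norm N B" by (intro K' B e) simp
      moreover have "N (B *\<^sub>v e) = 1 / N (unit_vec n j) * N (B *\<^sub>v unit_vec n j)"
      proof -
        have "B *\<^sub>v e = (1 / N (unit_vec n j)) \<cdot>\<^sub>v (B *\<^sub>v unit_vec n j)"
          unfolding e_def by (rule mult_mat_vec[OF B]) simp
        moreover have "B *\<^sub>v unit_vec n j \<in> carrier_vec n" using B by auto
        ultimately show ?thesis using pos by (simp add: vec_norm_on_smult[OF N])
      qed
      ultimately show ?thesis using pos by (simp add: field_simps)
    qed
    have "entry_sum B \<le> K * (\<Sum>j<n. N (B *\<^sub>v unit_vec n j))" by (rule K(2)[OF B])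
    also have "\<dots> \<le> K * ((\<Sum>j<n. N (unit_vec n j)) * induced_norm N B)"
      using K(1) col by (intro mult_left_mono) (auto simp: sum_distrib_right intro: sum_mono)
    also have "\<dots> \<le> ?K * induced_norm N B"
      using K(1) induced_norm_nonneg[OF N B] by (simp add: algebra_simps)
    finally show "entry_sum B \<le> ?K * induced_norm N B" .
  qed
qed

section \<open>Projection matrices\<close>

text \<open>Columnwise: \<open>P * X\<close> vanishes iff every column of \<open>X\<close> lies in
  the kernel of \<open>P\<close>, that is, is constant.\<close>

lemma projection_matrix_mult_eq_0_iff:
  assumes P: "projection_matrix m P" and X: "X \<in> carrier_mat m p"
  shows "P * X = 0\<^sub>m (m - 1) p \<longleftrightarrow> (\<forall>i<m. \<forall>j<m. \<forall>l<p. X $$ (i, l) = X $$ (j, l))"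
proof -
  have Pc: "P \<in> carrier_mat (m - 1) m"
    and ker: "mat_kernel P = {c \<cdot>\<^sub>v vec m (\<lambda>_. 1) | c. True}"
    using P by (auto simp: projection_matrix_def)
  have "P * X = 0\<^sub>m (m - 1) p \<longleftrightarrow> (\<forall>l<p. P *\<^sub>v col X l = 0\<^sub>v (m - 1))"
  proof
    assume *: "P * X = 0\<^sub>m (m - 1) p"
    show "\<forall>l<p. P *\<^sub>v col X l = 0\<^sub>v (m - 1)"
    proof (intro allI impI)
      fix l assume "l < p"
      have "col (P * X) l = P *\<^sub>v col X l" using \<open>l < p\<close> X by (intro col_mult2[OF Pc X])
      then show "P *\<^sub>v col X l = 0\<^sub>v (m - 1)" using * \<open>l < p\<close> by simp
    qed
  next
    assume *: "\<forall>l<p. P *\<^sub>v col X l = 0\<^sub>v (m - 1)"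
    show "P * X = 0\<^sub>m (m - 1) p"
      using Pc X * by (intro mat_col_eqI) (auto simp: col_mult2[OF Pc X] simp del: col_mult)
  qed
  also have "\<dots> \<longleftrightarrow> (\<forall>l<p. col X l \<in> mat_kernel P)"
    using Pc X by (auto simp: mat_kernel_def)
  also have "\<dots> \<longleftrightarrow> (\<forall>l<p. \<forall>i<m. \<forall>j<m. X $$ (i, l) = X $$ (j, l))"
  proof (intro all_cong1 imp_cong refl)
    fix l assume l: "l < p"
    show "col X l \<in> mat_kernel P \<longleftrightarrow> (\<forall>i<m. \<forall>j<m. X $$ (i, l) = X $$ (j, l))"
    proof
      assume "col X l \<in> mat_kernel P"
      then obtain c where c: "col X l = c \<cdot>\<^sub>v vec m (\<lambda>_. 1)" by (auto simp: ker)
      have "X $$ (i, l) = c" if "i < m" for i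
        using arg_cong[OF c, of "\<lambda>v. v $ i"] that l X by simp
      then show "\<forall>i<m. \<forall>j<m. X $$ (i, l) = X $$ (j, l)" by simp
    next
      assume *: "\<forall>i<m. \<forall>j<m. X $$ (i, l) = X $$ (j, l)"
      have "col X l = X $$ (0, l) \<cdot>\<^sub>v vec m (\<lambda>_. 1)"
      proof (intro eq_vecI)
        fix i assume "i < dim_vec (X $$ (0, l) \<cdot>\<^sub>v vec m (\<lambda>_. 1))"
        then have i: "i < m" by simp
        then have "X $$ (i, l) = X $$ (0, l)" using *[rule_format, of i 0] by linarith
        then show "col X l $ i = (X $$ (0, l) \<cdot>\<^sub>v vec m (\<lambda>_. 1)) $ i" using X l i by simp
      qed (use X in simp)
      then show "col X l \<in> mat_kernel P" by (auto simp: ker)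
    qed
  qed
  finally show ?thesis by blast
qed

text \<open>The kernel of \<open>P\<close> meets the zero-sum hyperplane only in \<open>0\<close>, so appending a row of ones to \<open>P\<close>
  makes it invertible.\<close>
lemma projection_matrix_right_inverse:
  assumes P: "projection_matrix m P" and m: "1 \<le> m"
  obtains Q where "Q \<in> carrier_mat m (m - 1)" "P * Q = 1\<^sub>m (m - 1)"
proof -
  have Pc: "P \<in> carrier_mat (m - 1) m"
    and ker: "mat_kernel P = {c \<cdot>\<^sub>v vec m (\<lambda>_. 1) | c. True}"
    using P by (auto simp: projection_matrix_def)
  define M where "M = mat m m (\<lambda>(i, j). if i < m - 1 then P $$ (i, j) else 1)"
  have M: "M \<in> carrier_mat m m" by (simp add: M_def)
  have rowM: "row M i = row P i" if "i < m - 1" for i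
    using that Pc by (intro eq_vecI) (auto simp: M_def)
  have "v = 0\<^sub>v m" if v: "v \<in> carrier_vec m" and Mv: "M *\<^sub>v v = 0\<^sub>v m" for v
  proof -
    have "P *\<^sub>v v = 0\<^sub>v (m - 1)"
    proof (intro eq_vecI)
      fix i assume i: "i < dim_vec (0\<^sub>v (m - 1) :: real vec)"
      then have "(M *\<^sub>v v) $ i = 0" using Mv by simp
      then show "(P *\<^sub>v v) $ i = 0\<^sub>v (m - 1) $ i" using i M Pc rowM[of i] by simp
    qed (use Pc in simp)
    then have "v \<in> mat_kernel P" using Pc v by (simp add: mat_kernel_def)
    then obtain c where c: "v = c \<cdot>\<^sub>v vec m (\<lambda>_. 1)" by (auto simp: ker)
    \<comment> \<open>The appended row of ones maps \<open>c\<close> times the ones vector to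
      \<open>real m * c\<close>, which forces \<open>c = 0\<close>.\<close>
    have "(M *\<^sub>v v) $ (m - 1) = (\<Sum>l<m. M $$ (m - 1, l) * v $ l)"
      using m by (intro index_mult_mat_vec_sum[OF M v]) auto
    also have "\<dots> = real m * c" using m by (simp add: M_def c)
    finally have "c = 0" using Mv m by simp
    then show ?thesis by (auto simp: c)
  qed
  then have "det M \<noteq> 0" using det_0_iff_vec_prod_zero[OF M] by blast
  from det_non_zero_imp_unit[OF M this, of "()"]
  obtain R where R: "R \<in> carrier_mat m m" and MR: "M * R = 1\<^sub>m m"
    by (auto simp: Units_def ring_mat_def)
  \<comment> \<open>\<open>P\<close> is the first \<open>m - 1\<close> rows of \<open>M\<close> and
    \<open>Q\<close> the first \<open>m - 1\<close> columns of \<open>R\<close>, so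
    \<open>P * Q\<close> is the upper left block of \<open>M * R\<close>, an identity
    matrix.\<close>
  define Q where "Q = mat m (m - 1) (\<lambda>(i, j). R $$ (i, j))"
  show thesis
  proof
    show "Q \<in> carrier_mat m (m - 1)" by (simp add: Q_def)
    show "P * Q = 1\<^sub>m (m - 1)"
    proof (intro eq_matI)
      fix i j assume "i < dim_row (1\<^sub>m (m - 1) :: real mat)" "j < dim_col (1\<^sub>m (m - 1) :: real mat)"
      then have ij: "i < m - 1" "j < m - 1" by auto
      have "col Q j = col R j" using ij R by (intro eq_vecI) (auto simp: Q_def)
      then have "(P * Q) $$ (i, j) = (M * R) $$ (i, j)"
        using ij Pc M R rowM[OF ij(1)] by (simp add: Q_def)
      then show "(P * Q) $$ (i, j) = 1\<^sub>m (m - 1) $$ (i, j)" using ij by (simp add: MR)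
    qed (use Pc in \<open>auto simp: Q_def\<close>)
  qed
qed

text \<open>Apply the previous criterion to \<open>X - Y\<close>. Thus \<open>P * X\<close> carries
  exactly the information in the row differences of \<open>X\<close>, which links projections to the
  Hajnal diameter.\<close>

lemma projection_matrix_mult_cong:
  assumes P: "projection_matrix m P" and X: "X \<in> carrier_mat m p" and Y: "Y \<in> carrier_mat m p"
  shows "P * X = P * Y \<longleftrightarrow>
    (\<forall>i<m. \<forall>j<m. \<forall>l<p. X $$ (i, l) - X $$ (j, l) = Y $$ (i, l) - Y $$ (j, l))"
proof -
  have Pc: "P \<in> carrier_mat (m - 1) m" using P by (simp add: projection_matrix_def)
  have "P * X = P * Y \<longleftrightarrow> P * X - P * Y = 0\<^sub>m (m - 1) p"
  proof
    assume "P * X - P * Y = 0\<^sub>m (m - 1) p"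
    then have "(P * X - P * Y) $$ (i, l) = 0" if "i < m - 1" "l < p" for i l using that by simp
    then show "P * X = P * Y" using Pc X Y by (intro eq_matI) auto
  qed (use Pc X Y in auto)
  also have "P * X - P * Y = P * (X - Y)" using Pc X Y by (simp add: mult_minus_distrib_mat)
  also have "P * (X - Y) = 0\<^sub>m (m - 1) p \<longleftrightarrow>
      (\<forall>i<m. \<forall>j<m. \<forall>l<p. (X - Y) $$ (i, l) = (X - Y) $$ (j, l))"
    using X Y by (intro projection_matrix_mult_eq_0_iff[OF P]) auto
  also have "\<dots> \<longleftrightarrow> (\<forall>i<m. \<forall>j<m. \<forall>l<p. X $$ (i, l) - X $$ (j, l) = Y $$ (i, l) - Y $$ (j, l))"
    using X Y by (intro all_cong1 imp_cong refl) (auto simp: algebra_simps)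
  finally show ?thesis .
qed

text \<open>Justifies the definite description in \<open>proj\<close>. The solution is
  \<open>P * A * Q\<close> with \<open>Q\<close> a right inverse of \<open>P\<close>; multiplying
  \<open>P * A = B * P\<close> by \<open>Q\<close> on the right gives uniqueness.\<close>

lemma proj_equation:
  assumes P: "projection_matrix m P" and m: "1 \<le> m" and A: "A \<in> equal_row_sums m"
  shows "proj P A \<in> carrier_mat (m - 1) (m - 1)" "P * A = proj P A * P"
proof -
  have Pc: "P \<in> carrier_mat (m - 1) m" using P by (simp add: projection_matrix_def)
  have Ac: "A \<in> carrier_mat m m"
    and rows: "\<And>i j. i < m \<Longrightarrow> j < m \<Longrightarrow> (\<Sum>k<m. A $$ (i, k)) = (\<Sum>k<m. A $$ (j, k))"
    using A unfolding equal_row_sums_def by blast+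
  obtain Q where Q: "Q \<in> carrier_mat m (m - 1)" and PQ: "P * Q = 1\<^sub>m (m - 1)"
    using projection_matrix_right_inverse[OF P m] by metis
  have QP: "Q * P \<in> carrier_mat m m" using Q Pc by auto
  have "P * (Q * P) = P * 1\<^sub>m m"
    unfolding assoc_mult_mat[OF Pc Q Pc, symmetric] PQ using Pc by simp
  then have diff: "(Q * P) $$ (i, l) - (Q * P) $$ (j, l) = 1\<^sub>m m $$ (i, l) - 1\<^sub>m m $$ (j, l)"
    if "i < m" "j < m" "l < m" for i j l
    using that projection_matrix_mult_cong[OF P QP one_carrier_mat] by blast
  \<comment> \<open>Since \<open>P * (Q * P) = P\<close>, all rows of
    \<open>Q * P - 1\<^sub>m m\<close> coincide; \<open>E\<close> is this common row.\<close>
  define E where "E l = (Q * P) $$ (0, l) - 1\<^sub>m m $$ (0, l)" for l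
  have QPE: "(Q * P) $$ (k, l) = 1\<^sub>m m $$ (k, l) + E l" if "k < m" "l < m" for k l
    using diff[of k 0 l] that m unfolding E_def by linarith
  have AQP: "(A * (Q * P)) $$ (i, l) = A $$ (i, l) + (\<Sum>k<m. A $$ (i, k)) * E l"
    if il: "i < m" "l < m" for i l
  proof -
    have "(A * (Q * P)) $$ (i, l) = (\<Sum>k<m. A $$ (i, k) * (1\<^sub>m m $$ (k, l) + E l))"
      unfolding index_mult_mat_sum[OF Ac QP il] using il by (intro sum.cong) (auto simp only: QPE lessThan_iff)
    also have "\<dots> = (\<Sum>k<m. A $$ (i, k) * 1\<^sub>m m $$ (k, l)) + (\<Sum>k<m. A $$ (i, k)) * E l"
      by (simp only: distrib_left sum.distrib sum_distrib_right)
    also have "(\<Sum>k<m. A $$ (i, k) * 1\<^sub>m m $$ (k, l)) = (A * 1\<^sub>m m) $$ (i, l)"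
      by (rule index_mult_mat_sum[OF Ac one_carrier_mat il, symmetric])
    also have "A * 1\<^sub>m m = A" by (rule right_mult_one_mat[OF Ac])
    finally show ?thesis .
  qed
  \<comment> \<open>Row \<open>i\<close> of \<open>A * (Q * P)\<close> is row \<open>i\<close> of
    \<open>A\<close> plus its row sum times \<open>E\<close>. Equal row sums make this correction
    the same in every row, so \<open>P\<close> removes it.\<close>
  have "P * (A * (Q * P)) = P * A"
  proof (rule projection_matrix_mult_cong[OF P mult_carrier_mat[OF Ac QP] Ac, THEN iffD2], intro allI impI)
    fix i j l assume "i < m" "j < m" "l < m"
    then show "(A * (Q * P)) $$ (i, l) - (A * (Q * P)) $$ (j, l) = A $$ (i, l) - A $$ (j, l)"
      unfolding AQP[OF \<open>i < m\<close> \<open>l < m\<close>] AQP[OF \<open>j < m\<close> \<open>l < m\<close>] rows[OF \<open>i < m\<close> \<open>j < m\<close>] by simp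
  qed
  moreover have "P * (A * (Q * P)) = P * A * Q * P"
    using assoc_mult_mat[OF Pc Ac QP] assoc_mult_mat[OF mult_carrier_mat[OF Pc Ac] Q Pc] by simp
  ultimately have PAQ: "P * A = P * A * Q * P" by simp
  have "\<exists>!B. B \<in> carrier_mat (m - 1) (m - 1) \<and> P * A = B * P"
  proof (rule ex1I)
    show "P * A * Q \<in> carrier_mat (m - 1) (m - 1) \<and> P * A = P * A * Q * P"
      by (intro conjI PAQ mult_carrier_mat[OF mult_carrier_mat[OF Pc Ac] Q])
    fix B assume "B \<in> carrier_mat (m - 1) (m - 1) \<and> P * A = B * P"
    then have B: "B \<in> carrier_mat (m - 1) (m - 1)" and PA: "P * A = B * P" by auto
    show "B = P * A * Q" unfolding PA assoc_mult_mat[OF B Pc Q] PQ using B by simp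
  qed
  from theI'[OF this] show "proj P A \<in> carrier_mat (m - 1) (m - 1)" "P * A = proj P A * P"
    unfolding proj_def carrier_matD(1)[OF Pc] by (rule conjunct1, rule conjunct2)
qed

text \<open>The relation \<open>P * A = proj P A * P\<close> moves \<open>P\<close> past one factor
  at a time, so it extends to products.\<close>

lemma left_prod_proj:
  assumes P: "projection_matrix m P" and m: "1 \<le> m"
    and A: "\<And>k. a \<le> k \<Longrightarrow> A k \<in> equal_row_sums m"
  defines "B \<equiv> left_prod (m - 1) (\<lambda>k. proj P (A k)) a"
  shows "left_prod m A a t \<in> carrier_mat m m" "B t \<in> carrier_mat (m - 1) (m - 1)"
    "P * left_prod m A a t = B t * P"
proof -
  have Pc: "P \<in> carrier_mat (m - 1) m" using P by (simp add: projection_matrix_def)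
  have "left_prod m A a t \<in> carrier_mat m m \<and> B t \<in> carrier_mat (m - 1) (m - 1) \<and>
    P * left_prod m A a t = B t * P"
  proof (induction t)
    case 0
    show ?case using Pc by (simp add: B_def)
  next
    case (Suc t)
    let ?C = "left_prod m A a t" and ?A = "A (a + t)" and ?p = "proj P (A (a + t))"
    have Ac: "?A \<in> carrier_mat m m" using A[of "a + t"] unfolding equal_row_sums_def by simp
    note p = proj_equation[OF P m A[of "a + t", OF le_add1]]
    have C: "?C \<in> carrier_mat m m" and B: "B t \<in> carrier_mat (m - 1) (m - 1)"
      and PC: "P * ?C = B t * P" using Suc by blast+
    have "P * (?A * ?C) = P * ?A * ?C" by (rule assoc_mult_mat[OF Pc Ac C, symmetric])
    also have "\<dots> = ?p * (P * ?C)" unfolding p(2) by (rule assoc_mult_mat[OF p(1) Pc C])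
    also have "\<dots> = ?p * B t * P" unfolding PC by (rule assoc_mult_mat[OF p(1) B Pc, symmetric])
    finally have "P * left_prod m A a (Suc t) = B (Suc t) * P" by (simp add: B_def)
    moreover have "left_prod m A a (Suc t) \<in> carrier_mat m m" using Ac C by simp
    moreover have "B (Suc t) \<in> carrier_mat (m - 1) (m - 1)" using p(1) B by (simp add: B_def)
    ultimately show ?case by blast
  qed
  then show "left_prod m A a t \<in> carrier_mat m m" "B t \<in> carrier_mat (m - 1) (m - 1)"
    "P * left_prod m A a t = B t * P" by blast+
qed

section \<open>Comparison of the diameter with the projected matrix\<close>

text \<open>\<open>Max\<close> behaves as a maximum here because the index pairs form a finite set,
  nonempty by \<open>1 \<le> m\<close>.\<close>

lemma diam_bounds:
  assumes N: "vec_norm_on m N" and C: "C \<in> carrier_mat m m" and m: "1 \<le> m"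
  shows "i < m \<Longrightarrow> j < m \<Longrightarrow> N (row C i - row C j) \<le> diam N C"
    and "(\<And>i j. i < m \<Longrightarrow> j < m \<Longrightarrow> N (row C i - row C j) \<le> K) \<Longrightarrow> diam N C \<le> K"
    and "0 \<le> diam N C"
proof -
  let ?S = "{N (row C i - row C j) | i j. i < dim_row C \<and> j < dim_row C}"
  have "?S = (\<lambda>(i, j). N (row C i - row C j)) ` ({..<m} \<times> {..<m})" using C by auto
  then have fin: "finite ?S" by simp
  have "N (row C 0 - row C 0) \<in> ?S"
    using C m by (intro CollectI exI[of _ 0] conjI refl) auto
  then have ne: "?S \<noteq> {}" by blast
  show le: "N (row C i - row C j) \<le> diam N C" if "i < m" "j < m" for i j
    unfolding diam_def using fin C that by (intro Max_ge) auto
  show "diam N C \<le> K" if "\<And>i j. i < m \<Longrightarrow> j < m \<Longrightarrow> N (row C i - row C j) \<le> K"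
    unfolding diam_def using fin ne C that by (subst Max_le_iff) auto
  have "0 \<le> N (row C 0 - row C 0)" using C m by (intro vec_norm_on_nonneg[OF N]) auto
  also have "\<dots> \<le> diam N C" using m by (intro le) auto
  finally show "0 \<le> diam N C" .
qed

text \<open>\<open>P * (Q * B * P) = B * P = P * C\<close>, so \<open>C\<close> and
  \<open>Q * B * P\<close> have the same row differences, and the entries of the latter are
  controlled by those of \<open>B\<close>.\<close>

lemma diam_le_entry_sum:
  assumes P: "projection_matrix m P" and m: "1 \<le> m" and N: "vec_norm_on m N"
  obtains K where "0 < K" "\<And>B C. B \<in> carrier_mat (m - 1) (m - 1) \<Longrightarrow> C \<in> carrier_mat m m \<Longrightarrow>
    P * C = B * P \<Longrightarrow> diam N C \<le> K * entry_sum B"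
proof -
  have Pc: "P \<in> carrier_mat (m - 1) m" using P by (simp add: projection_matrix_def)
  obtain Q where Q: "Q \<in> carrier_mat m (m - 1)" and PQ: "P * Q = 1\<^sub>m (m - 1)"
    using projection_matrix_right_inverse[OF P m] by metis
  obtain K where K: "0 < K" "\<And>v :: real vec. v \<in> carrier_vec m \<Longrightarrow> N v \<le> K * (\<Sum>i<m. \<bar>v $ i\<bar>)"
    using vec_norm_on_upper[OF N] by metis
  \<comment> \<open>The 2 counts the two rows of a difference; the 1 keeps the constant positive for
    \<open>m = 1\<close>, where \<open>P\<close> and \<open>Q\<close> have no entries.\<close>
  let ?K = "K * (2 * (entry_sum Q * entry_sum P) + 1)"
  show thesis
  proof
    have "0 \<le> entry_sum Q * entry_sum P" by (simp add: entry_sum_nonneg)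
    then show "0 < ?K" using K(1) by simp
    fix B C assume B: "B \<in> carrier_mat (m - 1) (m - 1)" and C: "C \<in> carrier_mat m m"
      and PC: "P * C = B * P"
    let ?D = "Q * B * P"
    have D: "?D \<in> carrier_mat m m" using Q B Pc by auto
    have "P * ?D = P * (Q * B) * P" by (rule assoc_mult_mat[OF Pc mult_carrier_mat[OF Q B] Pc, symmetric])
    also have "P * (Q * B) = P * Q * B" by (rule assoc_mult_mat[OF Pc Q B, symmetric])
    finally have "P * ?D = P * Q * B * P" .
    then have "P * C = P * ?D" using PQ PC B by simp
    then have eq: "C $$ (i, l) - C $$ (j, l) = ?D $$ (i, l) - ?D $$ (j, l)"
      if "i < m" "j < m" "l < m" for i j l
      using that projection_matrix_mult_cong[OF P C D] by blast
    have D_le: "(\<Sum>l<m. \<bar>?D $$ (i, l)\<bar>) \<le> entry_sum Q * entry_sum B * entry_sum P" if "i < m" for i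
      using row_sum_le_entry_sum[of i ?D] entry_sum_mult3[OF Q B Pc] that Q Pc
      by (simp del: index_mult_mat(1))
    show "diam N C \<le> ?K * entry_sum B"
    proof (rule diam_bounds(2)[OF N C m])
      fix i j assume i: "i < m" and j: "j < m"
      have "N (row C i - row C j) \<le> K * (\<Sum>l<m. \<bar>(row C i - row C j) $ l\<bar>)"
        using C by (intro K) auto
      also have "(\<Sum>l<m. \<bar>(row C i - row C j) $ l\<bar>) = (\<Sum>l<m. \<bar>?D $$ (i, l) - ?D $$ (j, l)\<bar>)"
        using C i j by (intro sum.cong) (auto simp flip: eq)
      also have "\<dots> \<le> (\<Sum>l<m. \<bar>?D $$ (i, l)\<bar>) + (\<Sum>l<m. \<bar>?D $$ (j, l)\<bar>)"
        unfolding sum.distrib[symmetric] by (intro sum_mono) (rule abs_triangle_ineq4)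
      also have "\<dots> \<le> 2 * (entry_sum Q * entry_sum P) * entry_sum B"
        using D_le[OF i] D_le[OF j] by (simp add: mult_ac)
      also have "\<dots> \<le> (2 * (entry_sum Q * entry_sum P) + 1) * entry_sum B"
        using entry_sum_nonneg[of B] by (simp add: algebra_simps)
      finally show "N (row C i - row C j) \<le> ?K * entry_sum B" using K(1) by (simp add: mult.assoc)
    qed
  qed
qed

lemma entry_sum_le_diam:
  assumes P: "projection_matrix m P" and m: "1 \<le> m" and N: "vec_norm_on m N"
  obtains K where "0 < K" "\<And>B C. B \<in> carrier_mat (m - 1) (m - 1) \<Longrightarrow> C \<in> carrier_mat m m \<Longrightarrow>
    P * C = B * P \<Longrightarrow> entry_sum B \<le> K * diam N C"
proof -
  have Pc: "P \<in> carrier_mat (m - 1) m" using P by (simp add: projection_matrix_def)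
  obtain Q where Q: "Q \<in> carrier_mat m (m - 1)" and PQ: "P * Q = 1\<^sub>m (m - 1)"
    using projection_matrix_right_inverse[OF P m] by metis
  obtain K where K: "0 < K" "\<And>v :: real vec. v \<in> carrier_vec m \<Longrightarrow> (\<Sum>i<m. \<bar>v $ i\<bar>) \<le> K * N v"
    using vec_norm_on_lower[OF N] by metis
  let ?K = "real m * K * (entry_sum P * entry_sum Q) + 1"
  show thesis
  proof
    show "0 < ?K" using K(1) by (simp add: entry_sum_nonneg add_nonneg_pos)
    fix B C assume B: "B \<in> carrier_mat (m - 1) (m - 1)" and C: "C \<in> carrier_mat m m"
      and PC: "P * C = B * P"
    \<comment> \<open>Subtracting the first row preserves row differences, so
      \<open>P * D = P * C\<close> and \<open>B = P * D * Q\<close>; unlike those of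
      \<open>C\<close>, the entries of \<open>D\<close> are bounded by the diameter.\<close>
    define D where "D = mat m m (\<lambda>(i, l). C $$ (i, l) - C $$ (0, l))"
    have D: "D \<in> carrier_mat m m" by (simp add: D_def)
    have "P * D = P * C"
      by (subst projection_matrix_mult_cong[OF P D C]) (auto simp: D_def)
    then have "P * D * Q = B * P * Q" using PC by simp
    also have "\<dots> = B" unfolding assoc_mult_mat[OF B Pc Q] PQ using B by simp
    finally have "entry_sum B \<le> entry_sum P * entry_sum D * entry_sum Q"
      using entry_sum_mult3[OF Pc D Q] by simp
    also have "entry_sum D \<le> real m * K * diam N C"
    proof -
      have "entry_sum D = (\<Sum>i<m. \<Sum>l<m. \<bar>(row C i - row C 0) $ l\<bar>)"
        using C m by (auto simp: entry_sum_def D_def intro!: sum.cong)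
      also have "\<dots> \<le> (\<Sum>i<m. K * N (row C i - row C 0))"
        using C by (intro sum_mono K) auto
      also have "\<dots> \<le> (\<Sum>i<m. K * diam N C)"
        using K(1) m by (intro sum_mono mult_left_mono diam_bounds(1)[OF N C m]) auto
      finally show ?thesis by simp
    qed
    then have "entry_sum P * entry_sum D * entry_sum Q \<le> entry_sum P * (real m * K * diam N C) * entry_sum Q"
      by (intro mult_right_mono mult_left_mono entry_sum_nonneg)
    also have "\<dots> \<le> ?K * diam N C" using diam_bounds(3)[OF N C m] by (simp add: algebra_simps)
    finally show "entry_sum B \<le> ?K * diam N C" .
  qed
qed

text \<open>Each of the three quantities is identified with the growth of
  \<open>entry_sum (B t0 t)\<close>. For \<open>m = 1\<close> all of them are -\<infinity>, the
  supremum over \<open>v\<close> being empty.\<close>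

theorem lemma3:
  fixes \<Phi> :: "'a set" and \<rho> :: "nat \<Rightarrow> 'a \<Rightarrow> 'a" and L :: "nat \<Rightarrow> 'a \<Rightarrow> real mat"
    and m :: nat and P :: "real mat" and N N' :: "real vec \<Rightarrow> real" and \<phi> :: 'a
  assumes "1 \<le> m"
    and "semiflow \<Phi> \<rho>"
    and "\<And>t \<psi>. \<psi> \<in> \<Phi> \<Longrightarrow> L t \<psi> \<in> carrier_mat m m"
    and "\<And>t0 \<psi>. \<psi> \<in> \<Phi> \<Longrightarrow> range (gen_seq_map \<rho> L t0 \<psi>) \<subseteq> equal_row_sums m"
    and "projection_matrix m P"
    and "vec_norm_on m N"
    and "vec_norm_on (m - 1) N'"
    and "\<phi> \<in> \<Phi>"
  shows "(SUP v \<in> {v \<in> carrier_vec (m - 1). v \<noteq> 0\<^sub>v (m - 1)}. proj_lyapunov_exponent P N' \<rho> L \<phi> v)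
           = ln_ereal (proj_joint_spectral_radius P N' \<rho> L \<phi>)
       \<and> ln_ereal (proj_joint_spectral_radius P N' \<rho> L \<phi>)
           = ln_ereal (hajnal_diameter m N \<rho> L \<phi>)"
proof -
  note m = assms(1) and P = assms(5) and N = assms(6) and N' = assms(7)
  let ?n = "m - 1"
  have dimP: "dim_row P = ?n" using P unfolding projection_matrix_def by (blast dest: carrier_matD)
  define A where "A t0 k = L k (\<rho> (k - t0) \<phi>)" for t0 k
  define C where "C t0 t = left_prod m (A t0) t0 t" for t0 t
  define B where "B t0 t = proj_prod P \<rho> L \<phi> t0 t" for t0 t
  \<comment> \<open>For \<open>t0 \<le> k\<close> the subtraction is exact, and this matrix is
    \<open>A t0 k\<close>.\<close>
  have "gen_seq_map \<rho> L t0 \<phi> (k - t0) \<in> equal_row_sums m" for t0 k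
    using assms(4)[OF assms(8), of t0] by blast
  then have "A t0 k \<in> equal_row_sums m" if "t0 \<le> k" for t0 k
    using that unfolding A_def gen_seq_map_def by (metis le_add_diff_inverse2)
  from left_prod_proj[OF P m, of t0 "A t0" for t0, OF this]
  have C: "C t0 t \<in> carrier_mat m m" and B: "B t0 t \<in> carrier_mat ?n ?n"
    and PC: "P * C t0 t = B t0 t * P" for t0 t
    unfolding B_def C_def proj_prod_def dimP A_def[symmetric] by auto
  let ?E = "\<lambda>t0 t. entry_sum (B t0 t)"
  have lyap: "proj_lyapunov_exponent P N' \<rho> L \<phi> v = growth (\<lambda>t0 t. N' (B t0 t *\<^sub>v v))" for v
    by (simp add: proj_lyapunov_exponent_def growth_def B_def)
  have "ln_ereal (proj_joint_spectral_radius P N' \<rho> L \<phi>) = growth (\<lambda>t0 t. induced_norm N' (B t0 t))"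
    unfolding proj_joint_spectral_radius_def B_def[symmetric]
    by (intro ln_limsup_powr_eq_growth induced_norm_nonneg[OF N' B])
  also have "\<dots> = growth ?E"
  proof (rule antisym)
    obtain K where "0 < K" "\<And>B. B \<in> carrier_mat ?n ?n \<Longrightarrow> induced_norm N' B \<le> K * entry_sum B"
      using induced_norm_bounds[OF N'] by metis
    then show "growth (\<lambda>t0 t. induced_norm N' (B t0 t)) \<le> growth ?E" using B by (auto intro: growth_mono)
    obtain K' where "0 < K'" "\<And>B. B \<in> carrier_mat ?n ?n \<Longrightarrow> entry_sum B \<le> K' * induced_norm N' B"
      using entry_sum_le_induced_norm[OF N'] by metis
    then show "growth ?E \<le> growth (\<lambda>t0 t. induced_norm N' (B t0 t))" using B by (auto intro: growth_mono)
  qed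
  finally have radius: "ln_ereal (proj_joint_spectral_radius P N' \<rho> L \<phi>) = growth ?E" .
  have "ln_ereal (hajnal_diameter m N \<rho> L \<phi>) = growth (\<lambda>t0 t. diam N (C t0 t))"
    unfolding hajnal_diameter_def A_def[symmetric] C_def[symmetric]
    by (intro ln_limsup_powr_eq_growth diam_bounds(3)[OF N C m])
  also have "\<dots> = growth ?E"
  proof (rule antisym)
    obtain K where "0 < K" "\<And>B C. B \<in> carrier_mat ?n ?n \<Longrightarrow> C \<in> carrier_mat m m \<Longrightarrow>
        P * C = B * P \<Longrightarrow> diam N C \<le> K * entry_sum B"
      using diam_le_entry_sum[OF P m N] by metis
    then show "growth (\<lambda>t0 t. diam N (C t0 t)) \<le> growth ?E" using B C PC by (auto intro: growth_mono)
    obtain K' where "0 < K'" "\<And>B C. B \<in> carrier_mat ?n ?n \<Longrightarrow> C \<in> carrier_mat m m \<Longrightarrow>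
        P * C = B * P \<Longrightarrow> entry_sum B \<le> K' * diam N C"
      using entry_sum_le_diam[OF P m N] by metis
    then show "growth ?E \<le> growth (\<lambda>t0 t. diam N (C t0 t))" using B C PC by (auto intro: growth_mono)
  qed
  finally have diameter: "ln_ereal (hajnal_diameter m N \<rho> L \<phi>) = growth ?E" .
  let ?V = "{v \<in> carrier_vec ?n. v \<noteq> 0\<^sub>v ?n} :: real vec set"
  have "(SUP v \<in> ?V. growth (\<lambda>t0 t. N' (B t0 t *\<^sub>v v))) = growth ?E"
  proof (rule antisym)
    obtain K where K: "0 < K" "\<And>B v. B \<in> carrier_mat ?n ?n \<Longrightarrow> v \<in> carrier_vec ?n \<Longrightarrow>
        N' (B *\<^sub>v v) \<le> K * entry_sum B * N' v"
      using norm_mult_mat_vec_le[OF N'] by metis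
    show "(SUP v \<in> ?V. growth (\<lambda>t0 t. N' (B t0 t *\<^sub>v v))) \<le> growth ?E"
    proof (rule SUP_least)
      fix v :: "real vec" assume "v \<in> ?V"
      then have v: "v \<in> carrier_vec ?n" "v \<noteq> 0\<^sub>v ?n" by auto
      then have "0 < N' v" by (rule vec_norm_on_pos[OF N'])
      \<comment> \<open>The constant \<open>K * N' v\<close> depends on \<open>v\<close> but not on
        \<open>t0\<close> or \<open>t\<close>, so it leaves the growth rate unchanged; it is
        positive because \<open>v\<close> is nonzero.\<close>
      then show "growth (\<lambda>t0 t. N' (B t0 t *\<^sub>v v)) \<le> growth ?E"
        using K(1) K(2)[OF B v(1)] by (intro growth_mono[of "K * N' v"]) (auto simp: mult_ac)
    qed
    obtain K' where "0 < K'" "\<And>B. B \<in> carrier_mat ?n ?n \<Longrightarrow>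
        entry_sum B \<le> K' * (\<Sum>j<?n. N' (B *\<^sub>v unit_vec ?n j))"
      using entry_sum_le_columns[OF N'] by metis
    \<comment> \<open>Finitely many directions, the unit vectors, already attain the growth of the
      whole matrix.\<close>
    then have "growth ?E \<le> (SUP j\<in>{..<?n}. growth (\<lambda>t0 t. N' (B t0 t *\<^sub>v unit_vec ?n j)))"
      using B by (intro growth_le_SUP) auto
    also have "\<dots> \<le> (SUP v \<in> ?V. growth (\<lambda>t0 t. N' (B t0 t *\<^sub>v v)))"
    proof (rule SUP_least)
      fix j assume "j \<in> {..<?n}"
      then have "unit_vec ?n j \<in> ?V"
        by simp
      then show "growth (\<lambda>t0 t. N' (B t0 t *\<^sub>v unit_vec ?n j)) \<le>
          (SUP v \<in> ?V. growth (\<lambda>t0 t. N' (B t0 t *\<^sub>v v)))" by (rule SUP_upper)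
    qed
    finally show "growth ?E \<le> (SUP v \<in> ?V. growth (\<lambda>t0 t. N' (B t0 t *\<^sub>v v)))" .
  qed
  then show ?thesis by (simp only: lyap radius diameter)
qed

end
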